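(* Let $x_1,x_2,x_3,x_4$ be any four distinct points in $\mathbb{R}^3$. Then the Atiyah determinant of $(x_1,x_2,x_3,x_4)$ is non-zero.
   Context: Definition of the Atiyah determinant of $n$ distinct points $x_1,\dots,x_n\in\mathbb{R}^3$. Identify $\mathbb{R}^3$ with $\mathbb{R}\times\mathbb{C}$ in the standard way. Let $h:\mathbb{C}^2\to\mathbb{R}\times\mathbb{C}$ be the Hopf mapping $$h(w_1,w_2)=\left(\tfrac12(|w_1|^2-|w_2|^2),\; w_1\bar w_2\right),$$ which maps $\mathbb{C}^2\setminus\{0\}$ onto $\mathbb{R}^3\setminus\{0\}$; preimages of a given nonzero point are unique up to multiplication by a phase $e^{i\theta}$. Let $\sigma:\mathbb{C}^2\to\mathbb{C}^2$, $\sigma(w_1,w_2)=(-\bar w_2,\bar w_1)$; then $h(\sigma(w))=-h(w)$. For each pair $j<i$ choose $w_{ij}\in\mathbb{C}^2\setminus\{0\}$ with $h(w_{ij})=x_i-x_j$. For each ordered pair of distinct indices $(k,l)$, define the lift $u_{k,l}\in\mathbb{C}^2$ of the direction from $x_k$ to $x_l$ by $u_{k,l}=w_{lk}$ if $l>k$, and $u_{k,l}=\sigma(w_{kl})$ if $l<k$ (so $h(u_{k,l})=x_l-x_k$ in both cases). For each $k$, writing $u_{k,l}=(a_{k,l},b_{k,l})$, let $v_k\in\mathbb{C}^n$ be the vector of coefficients, listed in order of $t^0,t^1,\dots,t^{n-1}$, of the polynomial $\prod_{l\neq k}(a_{k,l}+b_{k,l}t)$ (that is, the symmetric tensor product of the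 $u_{k,l}$, $l\ne k$, in $\bigodot^{n-1}\mathbb{C}^2\cong\mathbb{C}^n$). Let $M$ be the $n\times n$ complex matrix with columns $v_1,\dots,v_n$. The Atiyah determinant of $(x_1,\dots,x_n)$ is $\det M\in\mathbb{C}$. It does not depend on the choices of the $w_{ij}$, nor on the ordering of the points. *)

theory Defs
  imports
    "HOL-Analysis.Cartesian_Space"
    "HOL-Computational_Algebra.Polynomial"
    "Jordan_Normal_Form.Determinant"
begin

no_notation vec_index (infixl "$" 100)

definition rc_of_vec :: "real ^ 3 \<Rightarrow> real \<times> complex" where
  "rc_of_vec v = (v $ 1, Complex (v $ 2) (v $ 3))"

definition hopf :: "complex \<times> complex \<Rightarrow> real \<times> complex" where
  "hopf w = (((cmod (fst w))\<^sup>2 - (cmod (snd w))\<^sup>2) / 2, fst w * cnj (snd w))"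

definition hopf_sigma :: "complex \<times> complex \<Rightarrow> complex \<times> complex" where
  "hopf_sigma w = (- cnj (snd w), cnj (fst w))"

text \<open>
  The points are \<open>x 0, \<dots>, x (n - 1)\<close>. The predicate says that \<open>w\<close> is an admissible choice of
  the lifts \<open>w i j\<close> for \<open>j < i < n\<close>; all other values of \<open>w\<close> are irrelevant.
\<close>
definition hopf_lifts ::
  "nat \<Rightarrow> (nat \<Rightarrow> real ^ 3) \<Rightarrow> (nat \<Rightarrow> nat \<Rightarrow> complex \<times> complex) \<Rightarrow> bool" where
  "hopf_lifts n x w \<longleftrightarrow>
     (\<forall>i<n. \<forall>j<i. w i j \<noteq> (0, 0) \<and> hopf (w i j) = rc_of_vec (x i - x j))"

definition dir_lift ::
  "(nat \<Rightarrow> nat \<Rightarrow> complex \<times> complex) \<Rightarrow> nat \<Rightarrow> nat \<Rightarrow> complex \<times> complex" where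
  "dir_lift w k l = (if l > k then w l k else hopf_sigma (w k l))"

definition atiyah_poly ::
  "nat \<Rightarrow> (nat \<Rightarrow> nat \<Rightarrow> complex \<times> complex) \<Rightarrow> nat \<Rightarrow> complex poly" where
  "atiyah_poly n w k =
     (\<Prod>l\<in>{..<n} - {k}. [:fst (dir_lift w k l), snd (dir_lift w k l):])"

definition atiyah_mat ::
  "nat \<Rightarrow> (nat \<Rightarrow> nat \<Rightarrow> complex \<times> complex) \<Rightarrow> complex mat" where
  "atiyah_mat n w = mat n n (\<lambda>(r, k). poly.coeff (atiyah_poly n w k) r)"

text \<open>
  The Atiyah determinant of \<open>x 0, \<dots>, x (n - 1)\<close> is \<open>atiyah_det n w\<close> for any \<open>w\<close> with
  \<open>hopf_lifts n x w\<close>. It is kept as a function of the lifts, so statements about it quantify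
  over all admissible choices; \<open>hopf_lifts_exist\<close> below shows that there is one.
\<close>
definition atiyah_det :: "nat \<Rightarrow> (nat \<Rightarrow> nat \<Rightarrow> complex \<times> complex) \<Rightarrow> complex" where
  "atiyah_det n w = Determinant.det (atiyah_mat n w)"

lemma hopf_hopf_sigma: "hopf (hopf_sigma w) = - hopf w"
  by (simp add: hopf_def hopf_sigma_def field_simps)

lemma hopf_dir_lift:
  assumes "hopf_lifts n x w" "k < n" "l < n" "k \<noteq> l"
  shows "hopf (dir_lift w k l) = rc_of_vec (x l - x k)"
  using assms
  by (auto simp: hopf_lifts_def dir_lift_def hopf_hopf_sigma rc_of_vec_def complex_eq_iff)

lemma hopf_surj: "\<exists>w. hopf w = p"
proof -
  obtain s z where p: "p = (s, z)" by (cases p)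
  define R where "R = sqrt (s\<^sup>2 + (cmod z)\<^sup>2)"
  have R2: "R\<^sup>2 = s\<^sup>2 + (cmod z)\<^sup>2" unfolding R_def by simp
  have Rs: "\<bar>s\<bar> \<le> R" unfolding R_def by (rule real_le_rsqrt) simp
  show ?thesis
  proof (cases "R + s = 0")
    case True
    then have "R\<^sup>2 = s\<^sup>2" by (simp add: power2_eq_square add_eq_0_iff)
    with R2 have z: "z = 0" by simp
    have "s \<le> 0" using True Rs by linarith
    then have "hopf (0, of_real (sqrt (- 2 * s))) = p" by (simp add: hopf_def p z)
    then show ?thesis ..
  next
    case False
    then have pos: "R + s > 0" using Rs by linarith
    define a where "a = sqrt (R + s)"
    have a: "a > 0" "a\<^sup>2 = R + s" using pos by (auto simp: a_def)
    have zz: "(cmod z)\<^sup>2 = (R - s) * (R + s)" using R2 by (simp add: power2_eq_square algebra_simps)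
    have "(cmod (cnj z / of_real a))\<^sup>2 = R - s"
      using a pos by (simp add: norm_divide power_divide zz)
    then have "hopf (of_real a, cnj z / of_real a) = p"
      using a by (simp add: hopf_def p)
    then show ?thesis ..
  qed
qed

lemma hopf_lifts_exist:
  fixes x :: "nat \<Rightarrow> real ^ 3"
  assumes "inj_on x {..<n}"
  shows "\<exists>w. hopf_lifts n x w"
proof -
  define w where "w = (\<lambda>i j. SOME w. hopf w = rc_of_vec (x i - x j))"
  have h: "hopf (w i j) = rc_of_vec (x i - x j)" for i j
    unfolding w_def by (rule someI_ex) (rule hopf_surj)
  have "w i j \<noteq> (0, 0)" if "i < n" "j < i" for i j
  proof
    assume "w i j = (0, 0)"
    with h[of i j] have "x i = x j"
      by (auto simp: hopf_def rc_of_vec_def Finite_Cartesian_Product.vec_eq_iff forall_3 complex_eq_iff)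
    with assms that show False by (auto dest!: inj_onD[of x "{..<n}" i j])
  qed
  with h have "hopf_lifts n x w" by (simp add: hopf_lifts_def)
  then show ?thesis by (rule exI[of _ w])
qed

end

theory Submission
  imports Defs
begin

text \<open>
  In the determinant each lift \<open>w i j = (a, b)\<close> enters bilinearly through \<open>(a, b)\<close> and
  \<open>(- cnj b, cnj a)\<close>, so only the products of a component with a conjugate component occur. These
  are \<open>r + s\<close>, \<open>r - s\<close>, \<open>z\<close> and \<open>cnj z\<close>, where \<open>(s, z)\<close> is the difference of the two points
  and \<open>r\<close> their distance. Expanding and using \<open>r\<^sup>2 = s\<^sup>2 + \<bar>z\<bar>\<^sup>2\<close> gives the formula of Eastwood and
  Norbury: the real part of the determinant is
  \<open>64 P - 4 d3 (r\<^sub>1\<^sub>0 r\<^sub>3\<^sub>2) (r\<^sub>2\<^sub>0 r\<^sub>3\<^sub>1) (r\<^sub>3\<^sub>0 r\<^sub>2\<^sub>1) + A + 288 V\<^sup>2\<close>, where \<open>P\<close> is the product of the six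
  distances, \<open>V\<close> the volume of the tetrahedron, \<open>d3 a b c = (a + b - c) (b + c - a) (c + a - b)\<close>, and
  \<open>A\<close> a sum over the vertices that is nonnegative by the triangle inequality. Since
  \<open>d3 a b c \<le> a b c\<close>, the real part is at least \<open>60 P > 0\<close>.
\<close>

section \<open>The determinant as a form in the edges\<close>

text \<open>
  The determinant for four points as a multilinear form in the edges: the arguments \<open>p\<close>, \<open>q\<close>, \<open>z\<close>, \<open>t\<close>
  stand for the products \<open>a * cnj a\<close>, \<open>b * cnj b\<close>, \<open>a * cnj b\<close>, \<open>b * cnj a\<close>. It is the expansion of
  the determinant (216 monomials), with the edges factored out one after the other.
\<close>

definition edge_form ::
  "(nat \<Rightarrow> nat \<Rightarrow> 'a::comm_ring_1) \<Rightarrow> (nat \<Rightarrow> nat \<Rightarrow> 'a) \<Rightarrow> (nat \<Rightarrow> nat \<Rightarrow> 'a) \<Rightarrow> (nat \<Rightarrow> nat \<Rightarrow> 'a) \<Rightarrow> 'a" where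
  "edge_form p q z t =
     p 2 0 * (p 3 1 * (p 3 0 * (p 2 1 * (p 1 0 + q 1 0) * (p 3 2 + q 3 2) + q 2 1 * (p 1 0
     * p 3 2 + z 1 0 * t 3 2) - z 2 1 * (p 1 0 + q 1 0) * t 3 2 - t 2 1 * z 1 0 * (p 3 2
     + q 3 2)) + q 3 0 * p 2 1 * (q 1 0 * q 3 2 + z 1 0 * t 3 2) + z 3 0 * (p 2 1 * (p 1 0
     + q 1 0) * t 3 2 + t 2 1 * (p 1 0 * q 3 2 - z 1 0 * t 3 2)) + t 3 0 * (p 2 1 * z 1 0
     * (p 3 2 + q 3 2) + z 2 1 * (q 1 0 * p 3 2 - z 1 0 * t 3 2))) + q 3 1 * (p 3 0 * (p 2 1
     * (p 1 0 * q 3 2 - z 1 0 * t 3 2) + q 2 1 * p 1 0 * (p 3 2 + q 3 2) + t 2 1 * (- p 1 0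
     * z 3 2 - z 1 0 * q 3 2)) + q 3 0 * (p 2 1 * (p 1 0 + q 1 0) * q 3 2 + q 2 1 * (p 1 0
     * q 3 2 - t 1 0 * z 3 2) + t 2 1 * (- p 1 0 * z 3 2 - z 1 0 * q 3 2)) + z 3 0 * ((p 2 1
     + q 2 1) * (p 1 0 * t 3 2 + t 1 0 * q 3 2) + t 2 1 * (- p 1 0 * p 3 2 - q 1 0 * q 3 2
     - z 1 0 * t 3 2 - t 1 0 * z 3 2))) + z 3 1 * (p 3 0 * (p 2 1 * (p 1 0 + q 1 0) * t 3 2
     + t 2 1 * (p 1 0 * q 3 2 - z 1 0 * t 3 2)) + q 3 0 * (p 2 1 * (q 1 0 * t 3 2 - t 1 0
     * q 3 2) + t 2 1 * (p 1 0 + q 1 0) * q 3 2) + z 3 0 * t 2 1 * (p 1 0 * t 3 2 + t 1 0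
     * q 3 2) + t 3 0 * p 2 1 * (q 1 0 * q 3 2 + z 1 0 * t 3 2)) + t 3 1 * (p 3 0 * (- p 2 1
     * z 1 0 * (p 3 2 + q 3 2) + q 2 1 * (p 1 0 * z 3 2 - z 1 0 * p 3 2) + z 2 1 * (p 1 0
     * p 3 2 + z 1 0 * t 3 2)) + z 3 0 * (p 2 1 * (p 1 0 * q 3 2 - z 1 0 * t 3 2) + q 2 1
     * p 1 0 * (p 3 2 + q 3 2) + t 2 1 * (- p 1 0 * z 3 2 - z 1 0 * q 3 2)))) + q 2 0 * (p 3 1
     * (p 3 0 * (p 2 1 * (q 1 0 * p 3 2 - z 1 0 * t 3 2) + q 2 1 * (p 1 0 + q 1 0) * p 3 2
     + z 2 1 * (- q 1 0 * t 3 2 - t 1 0 * p 3 2)) + q 3 0 * (p 2 1 * q 1 0 * (p 3 2 + q 3 2)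
     + q 2 1 * (q 1 0 * p 3 2 - t 1 0 * z 3 2) + z 2 1 * (- q 1 0 * t 3 2 - t 1 0 * p 3 2))
     + t 3 0 * ((p 2 1 + q 2 1) * (q 1 0 * z 3 2 + z 1 0 * p 3 2) + z 2 1 * (- p 1 0 * p 3 2
     - q 1 0 * q 3 2 - z 1 0 * t 3 2 - t 1 0 * z 3 2))) + q 3 1 * (p 3 0 * q 2 1 * (p 1 0
     * p 3 2 + t 1 0 * z 3 2) + q 3 0 * (p 2 1 * (q 1 0 * q 3 2 + t 1 0 * z 3 2) + q 2 1
     * (p 1 0 + q 1 0) * (p 3 2 + q 3 2) - z 2 1 * t 1 0 * (p 3 2 + q 3 2) - t 2 1 * (p 1 0
     + q 1 0) * z 3 2) + z 3 0 * (q 2 1 * t 1 0 * (p 3 2 + q 3 2) + t 2 1 * (p 1 0 * q 3 2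
     - t 1 0 * z 3 2)) + t 3 0 * (q 2 1 * (p 1 0 + q 1 0) * z 3 2 + z 2 1 * (q 1 0 * p 3 2
     - t 1 0 * z 3 2))) + z 3 1 * (q 3 0 * (p 2 1 * (q 1 0 * t 3 2 - t 1 0 * q 3 2) - q 2 1
     * t 1 0 * (p 3 2 + q 3 2) + t 2 1 * (q 1 0 * q 3 2 + t 1 0 * z 3 2)) + t 3 0 * (p 2 1
     * q 1 0 * (p 3 2 + q 3 2) + q 2 1 * (q 1 0 * p 3 2 - t 1 0 * z 3 2) + z 2 1 * (- q 1 0
     * t 3 2 - t 1 0 * p 3 2))) + t 3 1 * (p 3 0 * (q 2 1 * (p 1 0 * z 3 2 - z 1 0 * p 3 2)
     + z 2 1 * (p 1 0 + q 1 0) * p 3 2) + q 3 0 * (q 2 1 * (p 1 0 + q 1 0) * z 3 2 + z 2 1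
     * (q 1 0 * p 3 2 - t 1 0 * z 3 2)) + z 3 0 * q 2 1 * (p 1 0 * p 3 2 + t 1 0 * z 3 2)
     + t 3 0 * z 2 1 * (q 1 0 * z 3 2 + z 1 0 * p 3 2))) + z 2 0 * (p 3 1 * (p 3 0 * (- p 2 1
     * (p 1 0 + q 1 0) * t 3 2 + q 2 1 * (- p 1 0 * t 3 2 + t 1 0 * p 3 2) + t 2 1 * (p 1 0
     * p 3 2 + z 1 0 * t 3 2)) + t 3 0 * (p 2 1 * (q 1 0 * p 3 2 - z 1 0 * t 3 2) + q 2 1
     * (p 1 0 + q 1 0) * p 3 2 + z 2 1 * (- q 1 0 * t 3 2 - t 1 0 * p 3 2))) + q 3 1 * (p 3 0
     * (q 2 1 * (- p 1 0 * t 3 2 + t 1 0 * p 3 2) + t 2 1 * p 1 0 * (p 3 2 + q 3 2)) + q 3 0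
     * (q 2 1 * t 1 0 * (p 3 2 + q 3 2) + t 2 1 * (p 1 0 * q 3 2 - t 1 0 * z 3 2)) + z 3 0
     * t 2 1 * (p 1 0 * t 3 2 + t 1 0 * q 3 2) + t 3 0 * q 2 1 * (p 1 0 * p 3 2 + t 1 0
     * z 3 2)) + t 3 1 * (p 3 0 * (p 2 1 * (p 1 0 * p 3 2 + z 1 0 * t 3 2) + q 2 1 * (- p 1 0
     * q 3 2 - q 1 0 * p 3 2 + z 1 0 * t 3 2 + t 1 0 * z 3 2) + z 2 1 * (- p 1 0 * t 3 2 + t 1 0
     * p 3 2) + t 2 1 * (p 1 0 * z 3 2 - z 1 0 * p 3 2)) + q 3 0 * q 2 1 * (p 1 0 * p 3 2
     + t 1 0 * z 3 2) + z 3 0 * (q 2 1 * (- p 1 0 * t 3 2 + t 1 0 * p 3 2) + t 2 1 * p 1 0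
     * (p 3 2 + q 3 2)) + t 3 0 * (q 2 1 * (p 1 0 * z 3 2 - z 1 0 * p 3 2) + z 2 1 * (p 1 0
     + q 1 0) * p 3 2))) + t 2 0 * (p 3 1 * (p 3 0 * (p 2 1 * z 1 0 * (p 3 2 + q 3 2) + z 2 1
     * (q 1 0 * p 3 2 - z 1 0 * t 3 2)) + q 3 0 * (p 2 1 * (- q 1 0 * z 3 2 + z 1 0 * q 3 2)
     + z 2 1 * q 1 0 * (p 3 2 + q 3 2)) + z 3 0 * p 2 1 * (q 1 0 * q 3 2 + z 1 0 * t 3 2)
     + t 3 0 * z 2 1 * (q 1 0 * z 3 2 + z 1 0 * p 3 2)) + q 3 1 * (q 3 0 * (p 2 1 * (- q 1 0
     * z 3 2 + z 1 0 * q 3 2) - q 2 1 * (p 1 0 + q 1 0) * z 3 2 + z 2 1 * (q 1 0 * q 3 2 + t 1 0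
     * z 3 2)) + z 3 0 * (p 2 1 * (p 1 0 + q 1 0) * q 3 2 + q 2 1 * (p 1 0 * q 3 2 - t 1 0
     * z 3 2) + t 2 1 * (- p 1 0 * z 3 2 - z 1 0 * q 3 2))) + z 3 1 * (p 3 0 * p 2 1 * (q 1 0
     * q 3 2 + z 1 0 * t 3 2) + q 3 0 * (p 2 1 * (- p 1 0 * q 3 2 - q 1 0 * p 3 2 + z 1 0
     * t 3 2 + t 1 0 * z 3 2) + q 2 1 * (q 1 0 * q 3 2 + t 1 0 * z 3 2) + z 2 1 * (q 1 0 * t 3 2
     - t 1 0 * q 3 2) + t 2 1 * (- q 1 0 * z 3 2 + z 1 0 * q 3 2)) + z 3 0 * (p 2 1 * (q 1 0
     * t 3 2 - t 1 0 * q 3 2) + t 2 1 * (p 1 0 + q 1 0) * q 3 2) + t 3 0 * (p 2 1 * (- q 1 0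
     * z 3 2 + z 1 0 * q 3 2) + z 2 1 * q 1 0 * (p 3 2 + q 3 2))))"

text \<open>Each minor is again a \<open>mat\<close> of a function, so rewriting with this rule
  unrolls the determinant.\<close>

lemma det_mat_Suc:
  "Determinant.det (mat (Suc n) (Suc n) f) =
     (\<Sum>j<Suc n. f (0, j) * (-1) ^ j *
       Determinant.det (mat n n (\<lambda>(i, k). f (Suc i, if k < j then k else Suc k))))"
proof -
  have "mat_delete (mat (Suc n) (Suc n) f) 0 j =
      mat n n (\<lambda>(i, k). f (Suc i, if k < j then k else Suc k))" if "j < Suc n" for j
    using that by (intro eq_matI) (auto simp: mat_delete_def)
  then show ?thesis
    by (subst laplace_expansion_row[of _ "Suc n" 0]) (auto simp: cofactor_def intro!: sum.cong)
qed

text \<open>Laplace expansion by the 2 x 2 minors of columns 0 and 1.\<close>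

lemma det_mat_4:
  "Determinant.det (mat 4 4 (\<lambda>(i, j). f i j)) =
     (f 0 0 * f 1 1 - f 0 1 * f 1 0) * (f 2 2 * f 3 3 - f 2 3 * f 3 2)
   - (f 0 0 * f 2 1 - f 0 1 * f 2 0) * (f 1 2 * f 3 3 - f 1 3 * f 3 2)
   + (f 0 0 * f 3 1 - f 0 1 * f 3 0) * (f 1 2 * f 2 3 - f 1 3 * f 2 2)
   + (f 1 0 * f 2 1 - f 1 1 * f 2 0) * (f 0 2 * f 3 3 - f 0 3 * f 3 2)
   - (f 1 0 * f 3 1 - f 1 1 * f 3 0) * (f 0 2 * f 2 3 - f 0 3 * f 2 2)
   + (f 2 0 * f 3 1 - f 2 1 * f 3 0) * (f 0 2 * f 1 3 - f 0 3 * f 1 2)"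
  by (simp add: numeral_eq_Suc det_mat_Suc algebra_simps)

lemma coeff_prod_3_linear:
  fixes a b c d e f :: "'a::comm_ring_1"
  shows "poly.coeff ([:a, b:] * ([:c, d:] * [:e, f:])) 0 = a * c * e"
    and "poly.coeff ([:a, b:] * ([:c, d:] * [:e, f:])) 1 = a * c * f + a * d * e + b * c * e"
    and "poly.coeff ([:a, b:] * ([:c, d:] * [:e, f:])) 2 = a * d * f + b * c * f + b * d * e"
    and "poly.coeff ([:a, b:] * ([:c, d:] * [:e, f:])) 3 = b * d * f"
  by (simp_all add: numeral_eq_Suc algebra_simps)

lemma atiyah_det_4:
  "atiyah_det 4 w = edge_form
     (\<lambda>i j. fst (w i j) * cnj (fst (w i j))) (\<lambda>i j. snd (w i j) * cnj (snd (w i j)))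
     (\<lambda>i j. fst (w i j) * cnj (snd (w i j))) (\<lambda>i j. snd (w i j) * cnj (fst (w i j)))"
proof -
  have "{..<4::nat} - {0} = {1, 2, 3}" "{..<4::nat} - {1} = {0, 2, 3}"
    "{..<4::nat} - {2} = {0, 1, 3}" "{..<4::nat} - {3} = {0, 1, 2}"
    by auto
  then have poly:
    "atiyah_poly 4 w 0 = [:fst (w 1 0), snd (w 1 0):] *
      ([:fst (w 2 0), snd (w 2 0):] * [:fst (w 3 0), snd (w 3 0):])"
    "atiyah_poly 4 w 1 = [:- cnj (snd (w 1 0)), cnj (fst (w 1 0)):] *
      ([:fst (w 2 1), snd (w 2 1):] * [:fst (w 3 1), snd (w 3 1):])"
    "atiyah_poly 4 w 2 = [:- cnj (snd (w 2 0)), cnj (fst (w 2 0)):] *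
      ([:- cnj (snd (w 2 1)), cnj (fst (w 2 1)):] * [:fst (w 3 2), snd (w 3 2):])"
    "atiyah_poly 4 w 3 = [:- cnj (snd (w 3 0)), cnj (fst (w 3 0)):] *
      ([:- cnj (snd (w 3 1)), cnj (fst (w 3 1)):] * [:- cnj (snd (w 3 2)), cnj (fst (w 3 2)):])"
    by (simp_all add: atiyah_poly_def dir_lift_def hopf_sigma_def del: mult_pCons_left mult_pCons_right)
  show ?thesis
    unfolding atiyah_det_def atiyah_mat_def det_mat_4 poly coeff_prod_3_linear edge_form_def
    by Groebner_Basis.algebra
qed

section \<open>The real part of the determinant\<close>

definition d3 :: "'a::comm_ring_1 \<Rightarrow> 'a \<Rightarrow> 'a \<Rightarrow> 'a" where
  "d3 a b c = (a + b - c) * (b + c - a) * (c + a - b)"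

definition vertex_term :: "(nat \<Rightarrow> nat \<Rightarrow> 'a::comm_ring_1) \<Rightarrow> nat \<Rightarrow> nat \<Rightarrow> nat \<Rightarrow> nat \<Rightarrow> 'a" where
  "vertex_term r l i j k =
     (r l i * ((r l j + r l k)\<^sup>2 - (r j k)\<^sup>2) + r l j * ((r l i + r l k)\<^sup>2 - (r i k)\<^sup>2)
      + r l k * ((r l i + r l j)\<^sup>2 - (r i j)\<^sup>2)) * d3 (r i j) (r i k) (r j k)"

definition eastwood_norbury :: "(nat \<Rightarrow> nat \<Rightarrow> 'a::comm_ring_1) \<Rightarrow> 'a" where
  "eastwood_norbury r =
     64 * (r 1 0 * r 2 0 * r 2 1 * r 3 0 * r 3 1 * r 3 2)
     - 4 * d3 (r 1 0 * r 3 2) (r 2 0 * r 3 1) (r 3 0 * r 2 1)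
     + (vertex_term r 0 1 2 3 + vertex_term r 1 0 2 3 + vertex_term r 2 0 1 3 + vertex_term r 3 0 1 2)"

text \<open>In this form \<open>sq\<close> can replace the squared distances by coordinates. What is
  left of \<open>eastwood_norbury\<close> has degree at most one in each distance, like
  \<open>edge_form\<close>, so both can be compared as plain polynomials.\<close>

lemma d3_squares:
  "d3 a b c = a * (b\<^sup>2 + c\<^sup>2 - a\<^sup>2) + b * (c\<^sup>2 + a\<^sup>2 - b\<^sup>2) + c * (a\<^sup>2 + b\<^sup>2 - c\<^sup>2) - 2 * a * b * c"
  by (simp add: d3_def algebra_simps power2_eq_square)

text \<open>Once squares are replaced, the first factor keeps only the edges at \<open>l\<close> and
  the second only those of the opposite face, so their product creates no new squares of
  distances.\<close>

lemma vertex_term_squares: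
  "vertex_term r l i j k =
     (r l i * ((r l j)\<^sup>2 + (r l k)\<^sup>2 - (r j k)\<^sup>2) + r l j * ((r l i)\<^sup>2 + (r l k)\<^sup>2 - (r i k)\<^sup>2)
      + r l k * ((r l i)\<^sup>2 + (r l j)\<^sup>2 - (r i j)\<^sup>2) + 6 * (r l i * r l j * r l k)) *
     (r i j * ((r i k)\<^sup>2 + (r j k)\<^sup>2 - (r i j)\<^sup>2) + r i k * ((r j k)\<^sup>2 + (r i j)\<^sup>2 - (r i k)\<^sup>2)
      + r j k * ((r i j)\<^sup>2 + (r i k)\<^sup>2 - (r j k)\<^sup>2) - 2 * r i j * r i k * r j k)"
  unfolding vertex_term_def d3_squares
  by (rule arg_cong2[where f = "(*)"]) (simp_all add: algebra_simps power2_eq_square)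

text \<open>
  For \<open>t = cnj z\<close> the two summands are conjugate, and the expression squared on the right is
  \<open>2 * \<i>\<close> times a determinant of three real vectors, so \<open>- 2\<close> times its square is \<open>288 V\<^sup>2\<close>.
\<close>

lemma edge_form_add_swap:
  fixes r :: "nat \<Rightarrow> nat \<Rightarrow> 'a::idom" and s z t :: "nat \<Rightarrow> 'a"
  assumes sym: "\<And>i j. r i j = r j i"
    and sq: "\<And>i j. (r i j)\<^sup>2 = (s i - s j)\<^sup>2 + (z i - z j) * (t i - t j)"
    and base: "s 3 = 0" "z 3 = 0" "t 3 = 0"
  shows "edge_form (\<lambda>i j. r i j + (s i - s j)) (\<lambda>i j. r i j - (s i - s j))
           (\<lambda>i j. z i - z j) (\<lambda>i j. t i - t j)
       + edge_form (\<lambda>i j. r i j + (s i - s j)) (\<lambda>i j. r i j - (s i - s j))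
           (\<lambda>i j. t i - t j) (\<lambda>i j. z i - z j)
       = 2 * (eastwood_norbury r - 2 * (s 0 * (z 1 * t 2 - t 1 * z 2)
           - s 1 * (z 0 * t 2 - t 0 * z 2) + s 2 * (z 0 * t 1 - t 0 * z 1))\<^sup>2)"
proof -
  have ord: "r 0 1 = r 1 0" "r 0 2 = r 2 0" "r 1 2 = r 2 1"
    "r 0 3 = r 3 0" "r 1 3 = r 3 1" "r 2 3 = r 3 2"
    by (fact sym)+
  show ?thesis
    unfolding eastwood_norbury_def d3_squares vertex_term_squares ord power_mult_distrib sq base
      edge_form_def
    by Groebner_Basis.algebra
qed

section \<open>Positivity of the Eastwood-Norbury expression\<close>

text \<open>This is Schur's inequality of degree one: the difference of the two sides is the cyclic
  sum of \<open>a * (a - b) * (a - c)\<close>.\<close>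

lemma d3_le_mult:
  fixes a b c :: real
  assumes "0 \<le> a" "0 \<le> b" "0 \<le> c"
  shows "d3 a b c \<le> a * b * c"
proof -
  have sorted: "d3 a b c \<le> a * b * c" if "c \<le> b" "b \<le> a" "0 \<le> c" for a b c :: real
  proof -
    have "a * b * c - d3 a b c = (a - b)\<^sup>2 * (a + b - c) + c * ((a - c) * (b - c))"
      unfolding d3_def by Groebner_Basis.algebra
    moreover have "0 \<le> (a - b)\<^sup>2 * (a + b - c) + c * ((a - c) * (b - c))"
      using that by (intro add_nonneg_nonneg mult_nonneg_nonneg) auto
    ultimately show ?thesis by linarith
  qed
  have "d3 a b c = d3 b a c" "d3 a b c = d3 a c b" "d3 a b c = d3 c b a"
    "d3 a b c = d3 b c a" "d3 a b c = d3 c a b"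
    by (simp_all add: d3_def mult_ac add_ac)
  then show ?thesis
    using sorted[of c b a] sorted[of b c a] sorted[of c a b] sorted[of a c b] sorted[of b a c]
      sorted[of a b c] assms
    by (smt (verit) mult.commute mult.left_commute)
qed

lemma vertex_term_nonneg:
  fixes x :: "nat \<Rightarrow> 'a::metric_space"
  shows "vertex_term (\<lambda>i j. dist (x i) (x j)) l i j k \<ge> 0"
proof -
  have "(dist (x b) (x c))\<^sup>2 \<le> (dist (x l) (x b) + dist (x l) (x c))\<^sup>2" for b c
    by (intro power_mono dist_triangle3) auto
  moreover have "d3 (dist (x i) (x j)) (dist (x i) (x k)) (dist (x j) (x k)) \<ge> 0"
    unfolding d3_def
    using dist_triangle[of "x i" "x j" "x k"] dist_triangle[of "x i" "x k" "x j"]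
      dist_triangle[of "x j" "x k" "x i"]
    by (intro mult_nonneg_nonneg) (simp_all add: dist_commute)
  ultimately show ?thesis
    unfolding vertex_term_def by (intro mult_nonneg_nonneg add_nonneg_nonneg) auto
qed

lemma eastwood_norbury_pos:
  fixes x :: "nat \<Rightarrow> 'a::metric_space"
  assumes "inj_on x {..<4}"
  shows "eastwood_norbury (\<lambda>i j. dist (x i) (x j)) > 0"
proof -
  define r where "r = (\<lambda>i j. dist (x i) (x j))"
  have "x i \<noteq> x j" if "i < 4" "j < i" for i j
    using inj_onD[OF assms, of i j] that by auto
  then have pos: "r i j > 0" if "i < 4" "j < i" for i j
    using that by (simp add: r_def)
  have "d3 (r 1 0 * r 3 2) (r 2 0 * r 3 1) (r 3 0 * r 2 1)
      \<le> (r 1 0 * r 3 2) * (r 2 0 * r 3 1) * (r 3 0 * r 2 1)"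
    by (rule d3_le_mult) (simp_all add: r_def)
  also have "\<dots> = r 1 0 * r 2 0 * r 2 1 * r 3 0 * r 3 1 * r 3 2"
    by (simp add: mult_ac)
  moreover have "0 < r 1 0 * r 2 0 * r 2 1 * r 3 0 * r 3 1 * r 3 2"
    by (intro mult_pos_pos pos) auto
  moreover have "0 \<le> vertex_term r l i j k" for l i j k
    unfolding r_def by (rule vertex_term_nonneg)
  note this[of 0 1 2 3] this[of 1 0 2 3] this[of 2 0 1 3] this[of 3 0 1 2]
  ultimately show ?thesis
    unfolding eastwood_norbury_def r_def[symmetric] by linarith
qed

section \<open>From lifts to coordinates\<close>

text \<open>The squared moduli of \<open>a\<close> and \<open>b\<close> follow from their difference
  and their sum; the sum comes from
  \<open>(A + B)\<^sup>2 = (A - B)\<^sup>2 + 4 * A * B\<close>.\<close>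

lemma hopf_eq_rc_of_vec:
  assumes "hopf (a, b) = rc_of_vec v"
  shows "a * cnj a = of_real (norm v + v $ 1)" "b * cnj b = of_real (norm v - v $ 1)"
    "a * cnj b = Complex (v $ 2) (v $ 3)" "b * cnj a = cnj (Complex (v $ 2) (v $ 3))"
proof -
  have s: "(cmod a)\<^sup>2 - (cmod b)\<^sup>2 = 2 * v $ 1" and z: "a * cnj b = Complex (v $ 2) (v $ 3)"
    using assms by (auto simp: hopf_def rc_of_vec_def)
  have "(cmod a * cmod b)\<^sup>2 = (v $ 2)\<^sup>2 + (v $ 3)\<^sup>2"
    using arg_cong[OF z, of "\<lambda>z. (cmod z)\<^sup>2"] by (simp add: norm_mult cmod_power2)
  moreover have "((cmod a)\<^sup>2 + (cmod b)\<^sup>2)\<^sup>2 = ((cmod a)\<^sup>2 - (cmod b)\<^sup>2)\<^sup>2 + 4 * (cmod a * cmod b)\<^sup>2"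
    by Groebner_Basis.algebra
  ultimately have "((cmod a)\<^sup>2 + (cmod b)\<^sup>2)\<^sup>2 = 4 * ((v $ 1)\<^sup>2 + (v $ 2)\<^sup>2 + (v $ 3)\<^sup>2)"
    by (simp add: s power_mult_distrib)
  also have "\<dots> = (2 * norm v)\<^sup>2"
    by (simp add: norm_vec_def L2_set_def sum_3 power_mult_distrib)
  finally have n: "(cmod a)\<^sup>2 + (cmod b)\<^sup>2 = 2 * norm v"
    by (rule power2_eq_imp_eq) auto
  have "(cmod a)\<^sup>2 = norm v + v $ 1" "(cmod b)\<^sup>2 = norm v - v $ 1"
    using s n by simp_all
  then show "a * cnj a = of_real (norm v + v $ 1)" "b * cnj b = of_real (norm v - v $ 1)"
    by (metis complex_norm_square)+
  show "a * cnj b = Complex (v $ 2) (v $ 3)" by (fact z)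
  show "b * cnj a = cnj (Complex (v $ 2) (v $ 3))"
    unfolding z[symmetric] by simp
qed

text \<open>\<open>edge_form\<close> reads its arguments only at \<open>j < i < 4\<close>, exactly
  where \<open>hopf_lifts\<close> constrains \<open>w\<close>.\<close>

lemma edge_form_cong:
  assumes "\<And>i j. i < 4 \<Longrightarrow> j < i \<Longrightarrow> p i j = p' i j \<and> q i j = q' i j \<and> z i j = z' i j \<and> t i j = t' i j"
  shows "edge_form p q z t = edge_form p' q' z' t'"
  using assms unfolding edge_form_def by simp

lemma cnj_edge_form:
  "cnj (edge_form p q z t) =
     edge_form (\<lambda>i j. cnj (p i j)) (\<lambda>i j. cnj (q i j)) (\<lambda>i j. cnj (z i j)) (\<lambda>i j. cnj (t i j))"
  unfolding edge_form_def by simp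

lemma of_real_eastwood_norbury:
  "of_real (eastwood_norbury r) = eastwood_norbury (\<lambda>i j. of_real (r i j) :: 'a::{real_algebra_1, comm_ring_1})"
  by (simp add: eastwood_norbury_def vertex_term_def d3_def)

theorem theorem1:
  fixes x :: "nat \<Rightarrow> real ^ 3"
    and w :: "nat \<Rightarrow> nat \<Rightarrow> complex \<times> complex"
  assumes "inj_on x {..<4}"
    and "hopf_lifts 4 x w"
  shows "atiyah_det 4 w \<noteq> 0"
proof
  assume zero: "atiyah_det 4 w = 0"
  define r :: "nat \<Rightarrow> nat \<Rightarrow> complex" where "r i j = of_real (dist (x i) (x j))" for i j
  \<comment> \<open>Coordinates are taken relative to \<open>x 3\<close>, which yields the
    assumptions \<open>base\<close> of \<open>edge_form_add_swap\<close>.\<close>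
  define s :: "nat \<Rightarrow> complex" where "s i = of_real ((x i - x 3) $ 1)" for i
  define z where "z i = Complex ((x i - x 3) $ 2) ((x i - x 3) $ 3)" for i
  define t where "t i = cnj (z i)" for i
  have lifts: "fst (w i j) * cnj (fst (w i j)) = r i j + (s i - s j) \<and>
      snd (w i j) * cnj (snd (w i j)) = r i j - (s i - s j) \<and>
      fst (w i j) * cnj (snd (w i j)) = z i - z j \<and>
      snd (w i j) * cnj (fst (w i j)) = t i - t j" if "i < 4" "j < i" for i j
  proof -
    have "hopf (fst (w i j), snd (w i j)) = rc_of_vec (x i - x j)"
      using assms(2) that by (simp add: hopf_lifts_def)
    from hopf_eq_rc_of_vec[OF this] show ?thesis
      by (simp add: r_def s_def t_def z_def dist_norm complex_eq_iff)
  qed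
  define D where "D = edge_form (\<lambda>i j. r i j + (s i - s j)) (\<lambda>i j. r i j - (s i - s j))
    (\<lambda>i j. z i - z j) (\<lambda>i j. t i - t j)"
  have "D = atiyah_det 4 w"
    unfolding D_def atiyah_det_4 by (rule edge_form_cong) (simp add: lifts)
  with zero have "D = 0" by simp
  \<comment> \<open>\<open>r\<close> and \<open>s\<close> are real and \<open>t\<close> is the
    conjugate of \<open>z\<close>, so conjugation only exchanges the last two arguments.\<close>
  have cnj_D: "cnj D = edge_form (\<lambda>i j. r i j + (s i - s j)) (\<lambda>i j. r i j - (s i - s j))
      (\<lambda>i j. t i - t j) (\<lambda>i j. z i - z j)"
    unfolding D_def cnj_edge_form by (simp add: r_def s_def t_def)
  define W where "W = s 0 * (z 1 * t 2 - t 1 * z 2) - s 1 * (z 0 * t 2 - t 0 * z 2)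
    + s 2 * (z 0 * t 1 - t 0 * z 1)"
  have "D + cnj D = 2 * (eastwood_norbury r - 2 * W\<^sup>2)"
    unfolding cnj_D unfolding D_def W_def
  proof (rule edge_form_add_swap)
    show "(r i j)\<^sup>2 = (s i - s j)\<^sup>2 + (z i - z j) * (t i - t j)" for i j
    proof -
      have "(dist (x i) (x j))\<^sup>2 = ((x i - x j) $ 1)\<^sup>2 + ((x i - x j) $ 2)\<^sup>2 + ((x i - x j) $ 3)\<^sup>2"
        by (simp add: dist_norm norm_vec_def L2_set_def sum_3)
      then show ?thesis
        by (simp add: r_def s_def z_def t_def complex_eq_iff power2_eq_square algebra_simps flip: of_real_power)
    qed
  qed (simp_all add: r_def s_def z_def t_def dist_commute complex_eq_iff)
  with \<open>D = 0\<close> have "eastwood_norbury r = 2 * W\<^sup>2" by simp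
  moreover have "eastwood_norbury r = of_real (eastwood_norbury (\<lambda>i j. dist (x i) (x j)))"
    unfolding of_real_eastwood_norbury by (simp add: r_def[abs_def])
  \<comment> \<open>Conjugation swaps \<open>z\<close> and \<open>t\<close>, two columns of the
    determinant \<open>W\<close>, so \<open>W\<close> is purely imaginary and its square is at most
    0.\<close>
  moreover have "Re W = 0"
  proof -
    have "cnj W = - W" by (simp add: W_def s_def t_def algebra_simps)
    then show ?thesis by (simp add: complex_eq_iff)
  qed
  ultimately have "eastwood_norbury (\<lambda>i j. dist (x i) (x j)) = - 2 * (Im W)\<^sup>2"
    by (simp add: complex_eq_iff power2_eq_square)
  also have "\<dots> \<le> 0" by simp
  finally show False using eastwood_norbury_pos[OF assms(1)] by simp
qed

end
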